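(* Let $n\ge 3$ and let $f_1,f_2:\mathbb R_{>0}\to\mathbb R_{>0}$ be non-increasing. Then $\operatorname{UA}^*_{1,n}(f_1)+\operatorname{UA}^*_{1,n}(f_2)=\mathbb R^n$.
   Context: For $f:\mathbb R_{>0}\to\mathbb R_{>0}$, $\operatorname{UA}_{1,n}(f)$ is the set of $\mathbf{x}\in\mathbb R^n$ (viewed as row vectors/linear forms) such that for every sufficiently large $t>0$ there exist $\mathbf{q}\in\mathbb Z^n\smallsetminus\{0\}$ and $p\in\mathbb Z$ with $\|\mathbf{q}\|\le t$ and $|\mathbf{q}\cdot\mathbf{x}-p|\le f(t)$ ($\|\cdot\|$ the sup norm). $\operatorname{UA}^*_{1,n}(f)$ is the set of $\mathbf{x}\in\operatorname{UA}_{1,n}(f)$ that are totally irrational, i.e. not contained in any proper rational affine subspace of $\mathbb R^n$. The sum of sets is the Minkowski sum $\{\mathbf{x}+\mathbf{y}\}$. *)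

theory Defs
  imports "HOL-Analysis.Analysis" "HOL-Library.Set_Algebras"
begin

definition real_vec :: "int ^ 'n \<Rightarrow> real ^ 'n"
  where "real_vec q = (\<chi> i. real_of_int (q $ i))"

text \<open>
  Functions on the positive reals are represented by functions on all of \<open>real\<close>; only the
  values at large \<open>t\<close> matter here. \<^const>\<open>infnorm\<close> is the sup norm.
\<close>

definition UA :: "(real \<Rightarrow> real) \<Rightarrow> (real ^ 'n) set"
  where "UA f = {x. \<forall>\<^sub>F t in at_top. \<exists>(q :: int ^ 'n) (p :: int).
           q \<noteq> 0 \<and> infnorm (real_vec q) \<le> t \<and> \<bar>real_vec q \<bullet> x - real_of_int p\<bar> \<le> f t}"

text \<open>
  A rational affine subspace is an affine subspace defined over the rationals, i.e. the solution
  set of a system of linear equations \<open>a \<bullet> x = b\<close> with rational coefficients \<open>a\<close> and rational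
  right-hand side \<open>b\<close>. Inconsistent systems give the empty set, which contains no point and
  so has no influence on total irrationality.
\<close>

definition rational_affine_subspace :: "(real ^ 'n) set \<Rightarrow> bool"
  where "rational_affine_subspace S \<longleftrightarrow>
    (\<exists>E :: ((real ^ 'n) \<times> real) set.
       (\<forall>(a, b) \<in> E. (\<forall>i. a $ i \<in> \<rat>) \<and> b \<in> \<rat>) \<and>
       S = {x. \<forall>(a, b) \<in> E. a \<bullet> x = b})"

definition totally_irrational :: "real ^ 'n \<Rightarrow> bool"
  where "totally_irrational x \<longleftrightarrow>
    \<not> (\<exists>S. rational_affine_subspace S \<and> S \<noteq> UNIV \<and> x \<in> S)"

definition UA_star :: "(real \<Rightarrow> real) \<Rightarrow> (real ^ 'n) set"
  where "UA_star f = {x \<in> UA f. totally_irrational x}"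

end

theory Submission
  imports Defs
begin

text \<open>
  Both \<open>x\<close> and \<open>z - x\<close> are kept extremely close to rational hyperplanes \<open>H\<^sub>k\<close> and \<open>G\<^sub>k\<close>.
  Since \<open>n \<ge> 3\<close>, the flat \<open>H\<^sub>k \<inter> (z - G\<^sub>k)\<close> contains a line, and any integer vector
  not orthogonal to this line has large multiples \<open>q\<close> for which some hyperplane
  \<open>q \<bullet> x = p\<close> meets the line arbitrarily close to a given point. Take such a hyperplane as
  \<open>H\<^sub>k\<^sub>+\<^sub>1\<close>, stay so close to the triple intersection that \<open>H\<^sub>k\<close> is a good approximation up to
  the height of \<open>H\<^sub>k\<^sub>+\<^sub>1\<close>, and then replace \<open>G\<^sub>k\<close> in the same way. Between two rounds there is
  enough room to leave any one given hyperplane, so total irrationality of both summands is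
  obtained by running through the countably many rational hyperplanes.
\<close>

section \<open>Integer vectors, and small moves onto or off a hyperplane\<close>

lemma real_vec_0: "real_vec 0 = 0"
  by (simp add: real_vec_def vec_eq_iff)

lemma real_vec_scale: "real_vec (of_int N *s q) = real_of_int N *\<^sub>R real_vec q"
  by (simp add: real_vec_def vec_eq_iff)

lemma real_vec_axis: "real_vec (axis i 1) = axis i 1"
  by (simp add: real_vec_def vec_eq_iff axis_def)

lemma real_vec_add: "real_vec (q + q') = real_vec q + real_vec q'"
  by (simp add: real_vec_def vec_eq_iff)

lemma axis_notin_proper_subspace:
  fixes S :: "(real ^ 'n) set"
  assumes "subspace S" "S \<noteq> UNIV"
  obtains i where "axis i 1 \<notin> S"
proof -
  have "\<not> Basis \<subseteq> S"
    using assms span_minimal[of Basis S] by auto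
  then show ?thesis
    using that by (auto simp: Basis_vec_def)
qed

text \<open>A proper subspace misses some coordinate vector. If the one missed by \<open>S\<close>
  lies in \<open>T\<close> and the one missed by \<open>T\<close> lies in \<open>S\<close>, their
  sum lies in neither.\<close>

lemma int_vec_avoiding_two_subspaces:
  fixes S T :: "(real ^ 'n) set"
  assumes S: "subspace S" "S \<noteq> UNIV" and T: "subspace T" "T \<noteq> UNIV"
  obtains w :: "int ^ 'n" where "real_vec w \<notin> S" "real_vec w \<notin> T"
proof -
  obtain i where i: "axis i 1 \<notin> S"
    using axis_notin_proper_subspace[OF S] .
  obtain j where j: "axis j 1 \<notin> T"
    using axis_notin_proper_subspace[OF T] .
  consider "axis i 1 \<notin> T" | "axis j 1 \<notin> S" | "axis i 1 \<in> T" "axis j 1 \<in> S"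
    by blast
  then show ?thesis
  proof cases
    case 1
    with i show ?thesis using that[of "axis i 1"] by (simp add: real_vec_axis)
  next
    case 2
    with j show ?thesis using that[of "axis j 1"] by (simp add: real_vec_axis)
  next
    case 3
    then have "axis i 1 + axis j 1 \<notin> S" "axis i 1 + axis j 1 \<notin> T"
      using i j subspace_diff[OF S(1), of "axis i 1 + axis j 1" "axis j 1"]
        subspace_diff[OF T(1), of "axis i 1 + axis j 1" "axis i 1"] by auto
    then show ?thesis
      using that[of "axis i 1 + axis j 1"] by (simp add: real_vec_axis real_vec_add)
  qed
qed

text \<open>The component of \<open>w\<close> orthogonal to \<open>span S\<close> serves as
  \<open>v\<close>; its inner product with \<open>w\<close> is its own squared norm.\<close>

lemma orthogonal_vector_outside_span:
  fixes w :: "'a::euclidean_space"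
  assumes "w \<notin> span S"
  obtains v where "\<And>u. u \<in> S \<Longrightarrow> u \<bullet> v = 0" "w \<bullet> v \<noteq> 0"
proof -
  obtain y v where y: "y \<in> span S" and v: "\<And>u. u \<in> span S \<Longrightarrow> orthogonal v u" and w: "w = y + v"
    using orthogonal_subspace_decomp_exists[of S w] by metis
  have "y \<bullet> v = 0"
    using v[OF y] by (simp add: orthogonal_def inner_commute)
  moreover have "v \<noteq> 0"
    using y w assms by auto
  ultimately have "w \<bullet> v \<noteq> 0"
    using w by (simp add: inner_add_left)
  moreover have "u \<bullet> v = 0" if "u \<in> S" for u
    using v[OF span_base[OF that]] by (simp add: orthogonal_def inner_commute)
  ultimately show ?thesis
    using that by blast
qed

lemma span_neq_UNIV:
  fixes S :: "(real ^ 'n) set"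
  assumes "finite S" "card S < CARD('n)"
  shows "span S \<noteq> UNIV"
proof
  assume "span S = UNIV"
  then have "dim S = CARD('n)"
    by (metis dim_UNIV dim_span DIM_cart DIM_real mult.right_neutral)
  with dim_le_card'[OF assms(1)] assms(2) show False by simp
qed

text \<open>Moving along a direction \<open>v\<close> orthogonal to \<open>S\<close> keeps all
  incidences with normals in \<open>S\<close>. On the line \<open>c + s v\<close> the hyperplanes
  normal to \<open>N w\<close> with integer offset recur with period 1/(N |w.v|) in
  \<open>s\<close>, so a large \<open>N\<close> brings one arbitrarily close to \<open>c\<close>.
  Avoiding \<open>span T\<close> is what later gives independence of normals.\<close>

lemma nearby_point_on_int_hyperplane:
  fixes S T :: "(real ^ 'n) set" and c :: "real ^ 'n"
  assumes S: "finite S" "card S < CARD('n)" and T: "finite T" "card T < CARD('n)" and "e > 0"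
  obtains q :: "int ^ 'n" and p :: int and c'
  where "infnorm (real_vec q) \<ge> M" "real_vec q \<notin> span T" "dist c c' < e"
    "\<And>u. u \<in> S \<Longrightarrow> u \<bullet> c' = u \<bullet> c" "real_vec q \<bullet> c' = of_int p"
proof -
  obtain w :: "int ^ 'n" where wS: "real_vec w \<notin> span S" and wT: "real_vec w \<notin> span T"
    using int_vec_avoiding_two_subspaces[of "span S" "span T"] span_neq_UNIV[OF S] span_neq_UNIV[OF T]
    by (auto simp: subspace_span)
  obtain v where v: "\<And>u. u \<in> S \<Longrightarrow> u \<bullet> v = 0" and wv: "real_vec w \<bullet> v \<noteq> 0"
    using orthogonal_vector_outside_span[OF wS] by blast
  have w0: "infnorm (real_vec w) > 0"
    using wS by (auto simp: infnorm_pos_lt span_zero)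
  \<comment> \<open>The three entries of the maximum give, in this order, a positive multiplier,
    height at least \<open>M\<close>, and a displacement below \<open>e\<close>.\<close>
  define K where "K = max 1 (max (M / infnorm (real_vec w)) (norm v / (e * \<bar>real_vec w \<bullet> v\<bar>) + 1))"
  define N where "N = \<lceil>K\<rceil>"
  have NK: "real_of_int N \<ge> K"
    by (simp add: N_def)
  then have N1: "real_of_int N \<ge> 1" and NM: "real_of_int N \<ge> M / infnorm (real_vec w)"
    and Ne: "real_of_int N > norm v / (e * \<bar>real_vec w \<bullet> v\<bar>)"
    by (auto simp: K_def)
  define q where "q = of_int N *s w"
  have q: "real_vec q = real_of_int N *\<^sub>R real_vec w"
    by (simp only: q_def real_vec_scale)
  \<comment> \<open>Rounding down changes the inner product by at most 1, and \<open>s\<close> is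
    the parameter at which the line meets the hyperplane with the rounded offset.\<close>
  define p where "p = \<lfloor>real_vec q \<bullet> c\<rfloor>"
  define s where "s = (of_int p - real_vec q \<bullet> c) / (real_vec q \<bullet> v)"
  have qv: "real_vec q \<bullet> v \<noteq> 0"
    using wv N1 by (auto simp: q)
  show ?thesis
  proof (rule that[of q "c + s *\<^sub>R v" p])
    show "infnorm (real_vec q) \<ge> M"
      using NM N1 w0 by (simp add: q infnorm_mul field_simps)
    show "real_vec q \<notin> span T"
    proof
      assume "real_vec q \<in> span T"
      then have "inverse (real_of_int N) *\<^sub>R real_vec q \<in> span T"
        by (rule span_mul)
      then show False
        using wT N1 by (simp add: q)
    qed
    have "\<bar>s\<bar> \<le> 1 / \<bar>real_vec q \<bullet> v\<bar>"
      unfolding s_def abs_divide p_def by (intro divide_right_mono) linarith+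
    then have "\<bar>s\<bar> * norm v \<le> norm v / \<bar>real_vec q \<bullet> v\<bar>"
      using mult_right_mono[of _ _ "norm v"] by fastforce
    also have "\<dots> < e"
    proof -
      have "norm v < real_of_int N * (e * \<bar>real_vec w \<bullet> v\<bar>)"
        using Ne wv \<open>e > 0\<close> by (simp add: pos_divide_less_eq)
      also have "\<dots> = e * \<bar>real_vec q \<bullet> v\<bar>"
        using N1 by (simp add: q abs_mult)
      finally show ?thesis
        using qv by (simp add: pos_divide_less_eq)
    qed
    finally show "dist c (c + s *\<^sub>R v) < e"
      by (simp add: dist_norm)
    show "u \<bullet> (c + s *\<^sub>R v) = u \<bullet> c" if "u \<in> S" for u
      using v[OF that] by (simp add: inner_add_right)
    show "real_vec q \<bullet> (c + s *\<^sub>R v) = of_int p"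
      using qv by (simp add: s_def inner_add_right)
  qed
qed

lemma nearby_point_off_hyperplane:
  fixes a c :: "'a::euclidean_space"
  assumes a: "a \<notin> span S" and "e > 0"
  obtains c' where "dist c c' < e" "\<And>u. u \<in> S \<Longrightarrow> u \<bullet> c' = u \<bullet> c" "a \<bullet> c' \<noteq> b"
proof (cases "a \<bullet> c = b")
  case True
  obtain v where v: "\<And>u. u \<in> S \<Longrightarrow> u \<bullet> v = 0" "a \<bullet> v \<noteq> 0"
    using orthogonal_vector_outside_span[OF a] by blast
  then have v0: "norm v > 0" by auto
  show ?thesis
  proof (rule that[of "c + (e / (2 * norm v)) *\<^sub>R v"])
    show "dist c (c + (e / (2 * norm v)) *\<^sub>R v) < e"
      using v0 \<open>e > 0\<close> by (simp add: dist_norm)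
  qed (use v v0 True \<open>e > 0\<close> in \<open>auto simp: inner_add_right\<close>)
qed (use that[of c] \<open>e > 0\<close> in auto)

section \<open>One round of refinement\<close>

lemma cball_inside_open:
  fixes c :: "'a::metric_space"
  assumes "open U" "c \<in> U"
  obtains r where "r > 0" "cball c r \<subseteq> U"
  using assms open_contains_cball by metis

lemma open_near_hyperplane:
  fixes u y :: "'a::euclidean_space"
  shows "open {x. \<bar>u \<bullet> x - b\<bar> < d}" "open {x. \<bar>u \<bullet> (y - x) - b\<bar> < d}"
  by (intro open_Collect_less continuous_intros)+

text \<open>The centre moves three times, \<open>c\<close> to \<open>d\<close> to \<open>e\<close>
  to \<open>c'\<close>, each time within a ball that protects what was gained before: first
  \<open>q1\<close> is replaced, then \<open>q2\<close>, and finally the hyperplane given by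
  \<open>a\<close> and \<open>b\<close> is left.\<close>

lemma refine_hyperplanes:
  fixes q1 q2 :: "int ^ 'n" and p1 p2 :: int and a c z :: "real ^ 'n"
  assumes n: "CARD('n) \<ge> 3" and f1: "\<And>t. t > 0 \<Longrightarrow> f1 t > 0" and f2: "\<And>t. t > 0 \<Longrightarrow> f2 t > 0"
    and "a \<noteq> 0" "r > 0"
    and c1: "real_vec q1 \<bullet> c = of_int p1" and c2: "real_vec q2 \<bullet> (z - c) = of_int p2"
  obtains q1' q2' :: "int ^ 'n" and p1' p2' :: int and c' r'
  where "r' > 0" "real_vec q1' \<bullet> c' = of_int p1'" "real_vec q2' \<bullet> (z - c') = of_int p2'"
    "cball c' r' \<subseteq> cball c r"
    "infnorm (real_vec q1') \<ge> infnorm (real_vec q1) + 1"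
    "infnorm (real_vec q2') \<ge> infnorm (real_vec q2) + 1"
    "\<And>x. x \<in> cball c' r' \<Longrightarrow> \<bar>real_vec q1 \<bullet> x - of_int p1\<bar> \<le> f1 (infnorm (real_vec q1'))"
    "\<And>x. x \<in> cball c' r' \<Longrightarrow> \<bar>real_vec q2 \<bullet> (z - x) - of_int p2\<bar> \<le> f2 (infnorm (real_vec q2'))"
    "\<And>x. x \<in> cball c' r' \<Longrightarrow> a \<bullet> x \<noteq> b"
proof -
  \<comment> \<open>Here the dimension enters: two normals never span the space, so a direction
    orthogonal to both remains.\<close>
  have card2: "card {u, v} < CARD('n)" and card1: "card {u} < CARD('n)" for u v :: "real ^ 'n"
    using n card_insert_le_m1[of 2 "{v}" u] by auto
  have pos: "infnorm x + 1 > 0" for x :: "real ^ 'n"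
    using infnorm_pos_le[of x] by linarith

  obtain q1' p1' d where q1': "infnorm (real_vec q1') \<ge> infnorm (real_vec q1) + 1"
    and q1'a: "real_vec q1' \<notin> span {a}" and cd: "dist c d < r"
    and cd': "\<And>u. u \<in> {real_vec q1, real_vec q2} \<Longrightarrow> u \<bullet> d = u \<bullet> c"
    and d1': "real_vec q1' \<bullet> d = of_int p1'"
    by (rule nearby_point_on_int_hyperplane[of "{real_vec q1, real_vec q2}" "{a}" r "infnorm (real_vec q1) + 1" c])
      (use card1 card2 \<open>r > 0\<close> in blast)+
  have d: "real_vec q1 \<bullet> d = of_int p1" "real_vec q2 \<bullet> (z - d) = of_int p2"
    using cd' c1 c2 by (simp_all add: inner_diff_right)
  \<comment> \<open>The point \<open>d\<close> is still on the old hyperplane, so positivity of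
    \<open>f1\<close> at the new height leaves a whole ball of admissible points around it.\<close>
  have "f1 (infnorm (real_vec q1')) > 0"
    using f1 q1' pos[of "real_vec q1"] by simp
  then have "d \<in> ball c r \<inter> {x. \<bar>real_vec q1 \<bullet> x - of_int p1\<bar> < f1 (infnorm (real_vec q1'))}"
    using cd d by simp
  then obtain s where "s > 0" and
    s: "cball d s \<subseteq> ball c r \<inter> {x. \<bar>real_vec q1 \<bullet> x - of_int p1\<bar> < f1 (infnorm (real_vec q1'))}"
    using cball_inside_open[OF open_Int[OF open_ball open_near_hyperplane(1)]] by blast

  \<comment> \<open>The same move, now for the second summand at \<open>z - d\<close>. The old
    \<open>q1\<close> is dropped from the preserved normals, since the ball of radius
    \<open>s\<close> already secures its approximation.\<close>
  obtain q2' p2' y where q2': "infnorm (real_vec q2') \<ge> infnorm (real_vec q2) + 1"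
    and q2'a: "real_vec q2' \<notin> span {real_vec q1', a}" and dy: "dist (z - d) y < s"
    and dy': "\<And>u. u \<in> {real_vec q1', real_vec q2} \<Longrightarrow> u \<bullet> y = u \<bullet> (z - d)"
    and y2': "real_vec q2' \<bullet> y = of_int p2'"
    by (rule nearby_point_on_int_hyperplane[of "{real_vec q1', real_vec q2}" "{real_vec q1', a}" s
        "infnorm (real_vec q2) + 1" "z - d"]) (use card2 \<open>s > 0\<close> in blast)+
  have y: "real_vec q1' \<bullet> y = real_vec q1' \<bullet> (z - d)" "real_vec q2 \<bullet> y = of_int p2"
      "real_vec q2' \<bullet> y = of_int p2'"
    using dy' y2' d by simp_all
  define e where "e = z - y"
  have e: "real_vec q1' \<bullet> e = of_int p1'" "real_vec q2 \<bullet> (z - e) = of_int p2"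
      "real_vec q2' \<bullet> (z - e) = of_int p2'" and de: "dist d e < s"
    using y d1' dy by (auto simp: e_def inner_diff_right dist_norm norm_minus_commute algebra_simps)
  have "f2 (infnorm (real_vec q2')) > 0"
    using f2 q2' pos[of "real_vec q2"] by simp
  then have "e \<in> ball d s \<inter> {x. \<bar>real_vec q2 \<bullet> (z - x) - of_int p2\<bar> < f2 (infnorm (real_vec q2'))}"
    using de e by simp
  then obtain t where "t > 0" and
    t: "cball e t \<subseteq> ball d s \<inter> {x. \<bar>real_vec q2 \<bullet> (z - x) - of_int p2\<bar> < f2 (infnorm (real_vec q2'))}"
    using cball_inside_open[OF open_Int[OF open_ball open_near_hyperplane(2)]] by blast

  \<comment> \<open>Two applications of the exchange property: \<open>q1'\<close> avoids the span of
    \<open>a\<close>, and \<open>q2'\<close> that of \<open>q1'\<close> and \<open>a\<close>. Hence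
    \<open>a\<close> is outside the span of the new normals, and a move preserving both can change
    the value of \<open>a\<close>.\<close>
  have "a \<notin> span {real_vec q1'}"
    using in_span_insert[of a "real_vec q1'" "{}"] q1'a \<open>a \<noteq> 0\<close> by auto
  then have "a \<notin> span {real_vec q1', real_vec q2'}"
    using in_span_insert[of a "real_vec q2'" "{real_vec q1'}"] q2'a by (auto simp: insert_commute)
  then obtain c' where ec': "dist e c' < t" and "a \<bullet> c' \<noteq> b"
    and ec'': "\<And>u. u \<in> {real_vec q1', real_vec q2'} \<Longrightarrow> u \<bullet> c' = u \<bullet> e"
    using nearby_point_off_hyperplane[of a "{real_vec q1', real_vec q2'}" t e b] \<open>t > 0\<close> by blast
  then have c': "real_vec q1' \<bullet> c' = of_int p1'" "real_vec q2' \<bullet> c' = real_vec q2' \<bullet> e"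
      "a \<bullet> c' \<noteq> b"
    using e by simp_all
  have "open {x. a \<bullet> x \<noteq> b}"
    by (intro open_Collect_neq continuous_intros)
  moreover have "c' \<in> ball e t \<inter> {x. a \<bullet> x \<noteq> b}"
    using ec' c' by simp
  ultimately obtain r' where "r' > 0" and r': "cball c' r' \<subseteq> ball e t \<inter> {x. a \<bullet> x \<noteq> b}"
    using cball_inside_open[OF open_Int[OF open_ball]] by blast
  have sub: "cball c' r' \<subseteq> cball e t" "cball e t \<subseteq> cball d s" "cball d s \<subseteq> cball c r"
    using r' t s ball_subset_cball by blast+
  show ?thesis
  proof (rule that[of r' q1' c' p1' q2' p2'])
    show "real_vec q2' \<bullet> (z - c') = of_int p2'"
      using c' e by (simp add: inner_diff_right)
    show "\<bar>real_vec q1 \<bullet> x - of_int p1\<bar> \<le> f1 (infnorm (real_vec q1'))" if "x \<in> cball c' r'" for x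
    proof -
      have "x \<in> {x. \<bar>real_vec q1 \<bullet> x - of_int p1\<bar> < f1 (infnorm (real_vec q1'))}"
        using that sub s by blast
      then show ?thesis by simp
    qed
    show "\<bar>real_vec q2 \<bullet> (z - x) - of_int p2\<bar> \<le> f2 (infnorm (real_vec q2'))" if "x \<in> cball c' r'" for x
    proof -
      have "x \<in> {x. \<bar>real_vec q2 \<bullet> (z - x) - of_int p2\<bar> < f2 (infnorm (real_vec q2'))}"
        using that sub t by blast
      then show ?thesis by simp
    qed
    show "a \<bullet> x \<noteq> b" if "x \<in> cball c' r'" for x
      using that r' by blast
  qed (use \<open>r' > 0\<close> c' q1' q2' sub in auto)
qed

section \<open>From sequences of hyperplanes to a limit point\<close>

lemma UA_I:
  fixes q :: "nat \<Rightarrow> int ^ 'n" and p :: "nat \<Rightarrow> int"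
  assumes f: "antimono_on {0<..} f"
    and grow: "\<And>k. infnorm (real_vec (q (Suc k))) \<ge> infnorm (real_vec (q k)) + 1"
    and approx: "\<And>k. \<bar>real_vec (q k) \<bullet> x - of_int (p k)\<bar> \<le> f (infnorm (real_vec (q (Suc k))))"
  shows "x \<in> UA f"
proof -
  let ?h = "\<lambda>k. infnorm (real_vec (q k))"
  have h: "?h k \<ge> real k" for k
  proof (induction k)
    case (Suc k)
    then show ?case using grow[of k] by simp
  qed (simp add: infnorm_pos_le)
  have "\<exists>(v :: int ^ 'n) (b :: int). v \<noteq> 0 \<and> infnorm (real_vec v) \<le> t \<and> \<bar>real_vec v \<bullet> x - of_int b\<bar> \<le> f t"
    if t: "t \<ge> ?h 1" for t
  proof -
    have "?h 0 < ?h 1" using grow[of 0] by simp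
    obtain j where "t < real j" using reals_Archimedean2 by blast
    then have j: "t < ?h j" using h[of j] by linarith
    \<comment> \<open>The first height above \<open>t\<close> has index \<open>m\<close>, so the
      vector before it has height at most \<open>t\<close>, and its error is at most
      \<open>f\<close> at height \<open>m\<close>, hence at most \<open>f t\<close> by monotonicity.
      Starting from \<open>?h 1\<close> forces \<open>m\<close> to be at least 2, which makes that
      vector nonzero even if \<open>q 0\<close> is zero.\<close>
    define m where "m = (LEAST k. t < ?h k)"
    have m: "t < ?h m" unfolding m_def using j by (rule LeastI)
    have "m \<noteq> 0" "m \<noteq> 1"
      using m t \<open>?h 0 < ?h 1\<close> by (intro notI; simp)+
    then obtain k where k: "m = Suc (Suc k)"
      by (metis One_nat_def not0_implies_Suc)
    then have "\<not> t < ?h (Suc k)"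
      using not_less_Least[of "Suc k" "\<lambda>k. t < ?h k"] by (simp add: m_def)
    then have kt: "?h (Suc k) \<le> t" by simp
    have pos: "?h (Suc k) > 0" using h[of "Suc k"] by simp
    then have "f (?h m) \<le> f t"
      using monotone_onD[OF f, of t "?h m"] m kt by simp
    then have "\<bar>real_vec (q (Suc k)) \<bullet> x - of_int (p (Suc k))\<bar> \<le> f t"
      using approx[of "Suc k"] k by simp
    moreover have "q (Suc k) \<noteq> 0"
      using pos by (auto simp: real_vec_0 infnorm_0)
    ultimately show ?thesis using kt by blast
  qed
  then show ?thesis
    unfolding UA_def eventually_at_top_linorder by blast
qed

lemma UA_sum_avoiding_hyperplanes:
  fixes f1 f2 :: "real \<Rightarrow> real" and z :: "real ^ 'n"
  assumes n: "CARD('n) \<ge> 3" and f1: "\<And>t. t > 0 \<Longrightarrow> f1 t > 0" and f2: "\<And>t. t > 0 \<Longrightarrow> f2 t > 0"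
    and mono: "antimono_on {0<..} f1" "antimono_on {0<..} f2"
    and E: "countable E" "E \<noteq> {}" "\<And>a b. (a, b) \<in> E \<Longrightarrow> a \<noteq> 0"
  obtains x where "x \<in> UA f1" "z - x \<in> UA f2" "\<And>a b. (a, b) \<in> E \<Longrightarrow> a \<bullet> x \<noteq> b"
proof -
  define good where "good = (\<lambda>(q1 :: int ^ 'n, p1 :: int, q2 :: int ^ 'n, p2 :: int, c :: real ^ 'n, r :: real).
    r > 0 \<and> real_vec q1 \<bullet> c = of_int p1 \<and> real_vec q2 \<bullet> (z - c) = of_int p2)"
  \<comment> \<open>Round \<open>k\<close> leaves the \<open>k\<close>-th member of an enumeration
    of \<open>E\<close>; every condition is imposed on the whole new ball and so passes to the limit
    point.\<close>
  define ref where "ref = (\<lambda>k (q1 :: int ^ 'n, p1 :: int, q2 :: int ^ 'n, p2 :: int, c :: real ^ 'n, r :: real)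
      (q1' :: int ^ 'n, p1' :: int, q2' :: int ^ 'n, p2' :: int, c' :: real ^ 'n, r' :: real).
    cball c' r' \<subseteq> cball c r \<and>
    infnorm (real_vec q1') \<ge> infnorm (real_vec q1) + 1 \<and>
    infnorm (real_vec q2') \<ge> infnorm (real_vec q2) + 1 \<and>
    (\<forall>x \<in> cball c' r'. \<bar>real_vec q1 \<bullet> x - of_int p1\<bar> \<le> f1 (infnorm (real_vec q1')) \<and>
       \<bar>real_vec q2 \<bullet> (z - x) - of_int p2\<bar> \<le> f2 (infnorm (real_vec q2')) \<and>
       fst (from_nat_into E k) \<bullet> x \<noteq> snd (from_nat_into E k)))"
  \<comment> \<open>Zero normals with zero offsets satisfy the incidences trivially; the growth of
    heights makes all later normals nonzero.\<close>
  have "good (0, 0, 0, 0, 0, 1)"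
    by (simp add: good_def real_vec_0)
  moreover have "\<exists>s'. good s' \<and> ref k s s'" if s_good: "good s" for k s
  proof -
    obtain q1 p1 q2 p2 c r where s: "s = (q1, p1, q2, p2, c, r)"
      by (metis prod_cases6)
    have a: "fst (from_nat_into E k) \<noteq> 0"
      using E from_nat_into[OF E(2), of k] by (metis prod.collapse)
    obtain q1' q2' :: "int ^ 'n" and p1' p2' :: int and c' r'
    where "r' > 0" "real_vec q1' \<bullet> c' = of_int p1'" "real_vec q2' \<bullet> (z - c') = of_int p2'"
      "cball c' r' \<subseteq> cball c r"
      "infnorm (real_vec q1') \<ge> infnorm (real_vec q1) + 1"
      "infnorm (real_vec q2') \<ge> infnorm (real_vec q2) + 1"
      "\<And>x. x \<in> cball c' r' \<Longrightarrow> \<bar>real_vec q1 \<bullet> x - of_int p1\<bar> \<le> f1 (infnorm (real_vec q1'))"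
      "\<And>x. x \<in> cball c' r' \<Longrightarrow> \<bar>real_vec q2 \<bullet> (z - x) - of_int p2\<bar> \<le> f2 (infnorm (real_vec q2'))"
      "\<And>x. x \<in> cball c' r' \<Longrightarrow> fst (from_nat_into E k) \<bullet> x \<noteq> snd (from_nat_into E k)"
      by (rule refine_hyperplanes[where ?f1.0 = f1 and ?f2.0 = f2, OF n f1 f2 a, where r = r and ?q1.0 = q1 and c = c and ?p1.0 = p1
            and ?q2.0 = q2 and z = z and ?p2.0 = p2 and b = "snd (from_nat_into E k)"])
        (use s_good in \<open>auto simp: s good_def\<close>)
    then show ?thesis
      by (intro exI[of _ "(q1', p1', q2', p2', c', r')"]) (auto simp: s good_def ref_def)
  qed
  ultimately obtain st where st: "\<And>k. good (st k)" "\<And>k. ref k (st k) (st (Suc k))"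
    using dependent_nat_choice[of "\<lambda>_. good" ref] by metis
  define q1 where "q1 k = fst (st k)" for k
  define p1 where "p1 k = fst (snd (st k))" for k
  define q2 where "q2 k = fst (snd (snd (st k)))" for k
  define p2 where "p2 k = fst (snd (snd (snd (st k))))" for k
  define c where "c k = fst (snd (snd (snd (snd (st k)))))" for k
  define r where "r k = snd (snd (snd (snd (snd (st k)))))" for k
  have st_eq: "st k = (q1 k, p1 k, q2 k, p2 k, c k, r k)" for k
    by (simp add: q1_def p1_def q2_def p2_def c_def r_def)
  have r: "r k > 0" for k
    using st(1)[of k] by (simp add: st_eq good_def)
  note ref = st(2)[unfolded st_eq ref_def prod.case]
  have "cball (c m) (r m) \<subseteq> cball (c k) (r k)" if "k \<le> m" for k m
    using that by (rule lift_Suc_antimono_le[rotated]) (use ref in blast)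
  \<comment> \<open>Nested nonempty compact balls have a common point.\<close>
  then have "\<Inter> (range (\<lambda>k. cball (c k) (r k))) \<noteq> {}"
    using less_imp_le[OF r] by (intro compact_nest) (auto simp: not_less)
  then obtain x where x: "\<And>k. x \<in> cball (c k) (r k)"
    by blast
  show ?thesis
  proof (rule that)
    show "x \<in> UA f1"
      using ref x by (intro UA_I[of f1 q1 x p1] mono) blast+
    show "z - x \<in> UA f2"
      using ref x by (intro UA_I[of f2 q2 "z - x" p2] mono) blast+
    show "a \<bullet> x \<noteq> b" if ab: "(a, b) \<in> E" for a b
    proof -
      obtain k where "from_nat_into E k = (a, b)"
        using from_nat_into_surj[OF E(1) ab] by blast
      then show ?thesis
        using ref[of k] x[of "Suc k"] by force
    qed
  qed
qed

section \<open>Total irrationality and the sum of the two sets\<close>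

definition rational_hyperplanes :: "((real ^ 'n) \<times> real) set"
  where "rational_hyperplanes = {(a, b). a \<noteq> 0 \<and> (\<forall>i. a $ i \<in> \<rat>) \<and> b \<in> \<rat>}"

lemma countable_rational_hyperplanes: "countable (rational_hyperplanes :: ((real ^ 'n) \<times> real) set)"
proof (rule countable_subset)
  let ?g = "\<lambda>(u :: 'n \<Rightarrow> rat, v). (\<chi> i. real_of_rat (u i), real_of_rat v)"
  show "(rational_hyperplanes :: ((real ^ 'n) \<times> real) set) \<subseteq> range ?g"
  proof clarify
    fix a :: "real ^ 'n" and b
    assume "(a, b) \<in> rational_hyperplanes"
    then have "\<forall>i. \<exists>u. a $ i = real_of_rat u" "\<exists>v. b = real_of_rat v"
      by (auto simp: rational_hyperplanes_def Rats_def)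
    then obtain u v where "\<And>i. a $ i = real_of_rat (u i)" "b = real_of_rat v"
      by metis
    then show "(a, b) \<in> range ?g"
      by (intro image_eqI[of _ _ "(u, v)"]) (auto simp: vec_eq_iff)
  qed
  show "countable (range ?g)" by simp
qed

text \<open>A point \<open>y\<close> outside a proper rational affine subspace violates one of its
  equations. As \<open>x\<close> satisfies that equation, its normal is nonzero, and
  \<open>x\<close> lies on a rational hyperplane.\<close>

lemma totally_irrationalI:
  fixes x :: "real ^ 'n"
  assumes "\<And>a b. (a, b) \<in> rational_hyperplanes \<Longrightarrow> a \<bullet> x \<noteq> b"
  shows "totally_irrational x"
  unfolding totally_irrational_def
proof (rule notI, elim exE conjE)
  fix S assume "rational_affine_subspace S" "S \<noteq> UNIV" "x \<in> S"
  obtain E :: "((real ^ 'n) \<times> real) set" where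
    "\<forall>(a, b) \<in> E. (\<forall>i. a $ i \<in> \<rat>) \<and> b \<in> \<rat>" and S: "S = {x. \<forall>(a, b) \<in> E. a \<bullet> x = b}"
    using \<open>rational_affine_subspace S\<close> unfolding rational_affine_subspace_def by (elim exE conjE)
  then have E: "(\<forall>i. a $ i \<in> \<rat>) \<and> b \<in> \<rat>" if "(a, b) \<in> E" for a b
    using that by fast
  obtain y where "y \<notin> S"
    using \<open>S \<noteq> UNIV\<close> by auto
  then obtain a b where "(a, b) \<in> E" "a \<bullet> y \<noteq> b"
    using S by auto
  moreover have x: "a \<bullet> x = b"
    using \<open>x \<in> S\<close> \<open>(a, b) \<in> E\<close> S by auto
  moreover have ab: "\<forall>i. a $ i \<in> \<rat>" "b \<in> \<rat>"
    using E[OF \<open>(a, b) \<in> E\<close>] by auto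
  ultimately have "a \<noteq> 0" by auto
  with ab assms x show False
    by (auto simp: rational_hyperplanes_def)
qed

theorem theorem1p12:
  fixes f1 f2 :: "real \<Rightarrow> real"
  assumes "CARD('n::finite) \<ge> 3"
    and "\<And>t. t > 0 \<Longrightarrow> f1 t > 0" and "\<And>t. t > 0 \<Longrightarrow> f2 t > 0"
    and "antimono_on {0<..} f1" and "antimono_on {0<..} f2"
  shows "UA_star f1 + UA_star f2 = (UNIV :: (real ^ 'n) set)"
proof -
  have "z \<in> UA_star f1 + UA_star f2" for z :: "real ^ 'n"
  proof -
    let ?H = "rational_hyperplanes :: ((real ^ 'n) \<times> real) set"
    \<comment> \<open>The second family consists of the hyperplanes reflected by x -> z - x, so
      avoiding it handles the other summand. Its offsets may be irrational, but countability is
      preserved.\<close>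
    let ?E = "?H \<union> (\<lambda>(a, b). (a, a \<bullet> z - b)) ` ?H"
    have "(axis undefined 1, 0) \<in> ?H"
      by (auto simp: rational_hyperplanes_def axis_def vec_eq_iff)
    then have E: "countable ?E" "?E \<noteq> {}" "\<And>a b. (a, b) \<in> ?E \<Longrightarrow> a \<noteq> 0"
      by (auto simp: countable_rational_hyperplanes) (auto simp: rational_hyperplanes_def)
    obtain x where x: "x \<in> UA f1" "z - x \<in> UA f2" and av: "\<And>a b. (a, b) \<in> ?E \<Longrightarrow> a \<bullet> x \<noteq> b"
      using UA_sum_avoiding_hyperplanes[where ?f1.0 = f1 and ?f2.0 = f2, OF assms E(1,2), where z = z] E(3) by blast
    have "totally_irrational x"
      using av by (intro totally_irrationalI) blast
    moreover have "totally_irrational (z - x)"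
    proof (rule totally_irrationalI)
      fix a :: "real ^ 'n" and b assume "(a, b) \<in> ?H"
      then have "a \<bullet> x \<noteq> a \<bullet> z - b"
        by (intro av) force
      then show "a \<bullet> (z - x) \<noteq> b"
        by (simp add: inner_diff_right)
    qed
    ultimately have "x + (z - x) \<in> UA_star f1 + UA_star f2"
      using x by (intro set_plus_intro) (auto simp: UA_star_def)
    then show ?thesis by simp
  qed
  then show ?thesis by blast
qed

end
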